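(* Let $n$ be a positive integer, let $I$ be the $n\times n$ identity matrix, and let $|X|=\sqrt{\operatorname{tr}(X^\top X)}$ be the Frobenius norm. The double-well function $f:\mathbb{R}^{n\times n}\to\mathbb{R}$, $f(X)=|X-I|^2\,|X+I|^2$, is lifted SOS polyconvex, that is, it can be written as an SOS-convex polynomial of the minors of $X$.
   Context: Let $N=\sum_{s=1}^{n}\binom{n}{s}^2$ and let $p:\mathbb{R}^{n\times n}\to\mathbb{R}^N$ map a matrix $X$ to the list (in some fixed order) of all its minors of orders $1,\dots,n$. A polynomial is SOS if it is a finite sum of squares of real polynomials. A polynomial $g:\mathbb{R}^N\to\mathbb{R}$ is SOS convex if $\langle y,\nabla^2 g(x)y\rangle$ is an SOS polynomial in the $2N$ variables $(x,y)$. A polynomial $f:\mathbb{R}^{n\times n}\to\mathbb{R}$ is lifted SOS polyconvex if there is an SOS-convex polynomial $g:\mathbb{R}^N\to\mathbb{R}$ with $f=g\circ p$.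
   Formalization: The formal theorem assumes n ≥ 2 instead of n positive: for n = 1 the only minor is x, which forces g(x) = (x−1)²(x+1)² with second derivative −4 at 0, so the claim is false there. *)

theory Defs
  imports "Jordan_Normal_Form.Determinant" "HOL-Analysis.Analysis"
begin

no_notation Matrix.vec_index (infixl \<open>$\<close> 100)

text \<open>
  A minor of an \<open>n \<times> n\<close> matrix is given by a set of rows and a set of columns of the same
  positive size. The index type \<open>'n minor_index\<close> below plays the role of
  \<open>{1, \<dots>, N}\<close>, so that \<open>real ^ ('n minor_index)\<close> is \<open>\<real>\<^sup>N\<close>. The linear order
  on \<open>'n\<close> only fixes the order of the rows and columns of a submatrix.
\<close>

typedef ('n::finite) minor_index =
  "{(I, J). I \<noteq> {} \<and> card I = card J} :: ('n set \<times> 'n set) set"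
  by (rule exI[of _ "(UNIV, UNIV)"]) auto

instance minor_index :: (finite) finite
proof
  have "(UNIV :: 'a minor_index set) = Abs_minor_index ` {(I, J). I \<noteq> {} \<and> card I = card J}"
    using type_definition.Abs_image[OF type_definition_minor_index] by auto
  then show "finite (UNIV :: 'a minor_index set)"
    by (rule ssubst) (rule finite_imageI, rule finite)
qed

lemma card_minor_index:
  "CARD('n::finite minor_index) = (\<Sum>s=1..CARD('n). (CARD('n) choose s)\<^sup>2)"
proof -
  let ?P = "\<lambda>s. {I :: 'n set. card I = s}"
  have "CARD('n minor_index) = card {(I :: 'n set, J :: 'n set). I \<noteq> {} \<and> card I = card J}"
    by (rule type_definition.card[OF type_definition_minor_index])
  also have "{(I :: 'n set, J :: 'n set). I \<noteq> {} \<and> card I = card J} =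
      (\<Union>s\<in>{1..CARD('n)}. ?P s \<times> ?P s)"
  proof -
    have *: "I \<noteq> {} \<longleftrightarrow> card I \<in> {1..CARD('n)}" for I :: "'n set"
      by (simp add: card_gt_0_iff Suc_le_eq card_mono)
    show ?thesis unfolding * by auto
  qed
  also have "card \<dots> = (\<Sum>s=1..CARD('n). card (?P s \<times> ?P s))"
    by (rule card_UN_disjoint) auto
  also have "\<dots> = (\<Sum>s=1..CARD('n). (CARD('n) choose s)\<^sup>2)"
  proof (rule sum.cong)
    fix s
    have "card (?P s) = (CARD('n) choose s)"
      using n_subsets[of "UNIV :: 'n set" s] by simp
    then show "card (?P s \<times> ?P s) = (CARD('n) choose s)\<^sup>2"
      by (simp add: card_cartesian_product power2_eq_square)
  qed simp
  finally show ?thesis .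
qed

type_synonym 'n sq_matrix = "real^'n^'n"

definition minor :: "'n::{finite,linorder} set \<Rightarrow> 'n set \<Rightarrow> 'n sq_matrix \<Rightarrow> real" where
  "minor I J X = Determinant.det (Matrix.mat (card I) (card J)
     (\<lambda>(a, b). X $ (sorted_list_of_set I ! a) $ (sorted_list_of_set J ! b)))"

definition minors :: "'n::{finite,linorder} sq_matrix \<Rightarrow> real^('n minor_index)" where
  "minors X = (\<chi> k. case Rep_minor_index k of (I, J) \<Rightarrow> minor I J X)"

definition is_sos :: "('a::real_normed_vector \<Rightarrow> real) \<Rightarrow> bool" where
  "is_sos q \<longleftrightarrow> (\<exists>(m::nat) r. (\<forall>i<m. real_polynomial_function (r i)) \<and>
     q = (\<lambda>z. \<Sum>i<m. (r i z)\<^sup>2))"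

definition partial_deriv :: "'m::finite \<Rightarrow> (real^'m \<Rightarrow> real) \<Rightarrow> real^'m \<Rightarrow> real" where
  "partial_deriv i g x = deriv (\<lambda>t. g (x + t *\<^sub>R axis i 1)) 0"

definition hessian :: "(real^'m::finite \<Rightarrow> real) \<Rightarrow> real^'m \<Rightarrow> real^'m^'m" where
  "hessian g x = (\<chi> i j. partial_deriv i (partial_deriv j g) x)"

definition sos_convex :: "(real^'m::finite \<Rightarrow> real) \<Rightarrow> bool" where
  "sos_convex g \<longleftrightarrow> real_polynomial_function g \<and>
     is_sos (\<lambda>(x, y). inner y (hessian g x *v y))"

definition lifted_sos_polyconvex :: "('n::{finite,linorder} sq_matrix \<Rightarrow> real) \<Rightarrow> bool" where
  "lifted_sos_polyconvex f \<longleftrightarrow> real_polynomial_function f \<and> (\<exists>g. sos_convex g \<and> f = g \<circ> minors)"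

definition frobenius_norm :: "'n::finite sq_matrix \<Rightarrow> real" where
  "frobenius_norm X = sqrt (trace (Finite_Cartesian_Product.transpose X ** X))"

definition double_well :: "'n::finite sq_matrix \<Rightarrow> real" where
  "double_well X = (frobenius_norm (X - mat 1))\<^sup>2 * (frobenius_norm (X + mat 1))\<^sup>2"

text \<open>
  For \<open>n = 1\<close> the only minor of \<open>X = (x)\<close> is \<open>x\<close> itself, and
  \<open>(x - 1)\<^sup>2 (x + 1)\<^sup>2\<close> is not convex. So the double well is not lifted SOS polyconvex
  in that case, which is why a size of at least two has to be assumed for the positive result.
\<close>

lemma not_lifted_sos_polyconvex_double_well:
  assumes n1: "CARD('n::{finite,linorder}) = 1"
  shows "\<not> lifted_sos_polyconvex (double_well :: 'n sq_matrix \<Rightarrow> real)"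
proof
  assume "lifted_sos_polyconvex (double_well :: 'n sq_matrix \<Rightarrow> real)"
  then obtain g :: "real^('n minor_index) \<Rightarrow> real"
    where g: "sos_convex g" and fg: "double_well = g \<circ> minors"
    by (auto simp: lifted_sos_polyconvex_def)
  obtain a :: 'n where a: "(UNIV :: 'n set) = {a}"
    using n1 by (metis card_1_singletonE)
  have "CARD('n minor_index) = 1"
    by (simp add: card_minor_index n1)
  then obtain k :: "'n minor_index" where k: "(UNIV :: 'n minor_index set) = {k}"
    by (metis card_1_singletonE)
  have ia: "i = a" for i :: 'n using a by auto
  have ik: "i = k" for i :: "'n minor_index" using k by auto
  have sub: "I = {} \<or> I = {a}" for I :: "'n set"
    using a by (metis subset_singletonD subset_UNIV)
  have Rk: "Rep_minor_index k = ({a}, {a})"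
  proof -
    obtain I J where IJ: "Rep_minor_index k = (I, J)" by fastforce
    moreover have "I \<noteq> {}" "card I = card J"
      using Rep_minor_index[of k] by (auto simp: IJ)
    ultimately show ?thesis
      using sub[of I] sub[of J] by auto
  qed
  have min: "minors (mat t :: 'n sq_matrix) = t *\<^sub>R axis k 1" for t
  proof -
    have "minors (mat t :: 'n sq_matrix) $ i = (t *\<^sub>R axis k 1 :: real^('n minor_index)) $ i" for i
      unfolding ik[of i]
      by (simp add: minors_def Rk minor_def Finite_Cartesian_Product.mat_def axis_def det_single)
    then show ?thesis by (simp add: Finite_Cartesian_Product.vec_eq_iff)
  qed
  have fr: "(frobenius_norm (mat t :: 'n sq_matrix))\<^sup>2 = t\<^sup>2" for t :: real
    by (simp add: frobenius_norm_def trace_def matrix_matrix_mult_def a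
        Finite_Cartesian_Product.mat_def Finite_Cartesian_Product.transpose_def)
  have m: "(mat t - mat 1 :: 'n sq_matrix) = mat (t - 1)" "(mat t + mat 1 :: 'n sq_matrix) = mat (t + 1)" for t
    by (auto simp: Finite_Cartesian_Product.vec_eq_iff Finite_Cartesian_Product.mat_def)
  have h: "g (t *\<^sub>R axis k 1) = (t - 1)\<^sup>2 * (t + 1)\<^sup>2" for t
    using fun_cong[OF fg, of "mat t"] by (simp add: min double_well_def m fr)
  have x: "x = (x $ k) *\<^sub>R axis k 1" for x :: "real^('n minor_index)"
    by (simp add: Finite_Cartesian_Product.vec_eq_iff axis_def) (metis ik)
  have d1: "partial_deriv k g x = 4 * (x $ k) * ((x $ k)\<^sup>2 - 1)" for x
  proof -
    have eq: "g (x + t *\<^sub>R axis k 1) = ((x $ k + t) - 1)\<^sup>2 * ((x $ k + t) + 1)\<^sup>2" for t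
      by (subst x) (simp only: h flip: scaleR_add_left)
    have "((\<lambda>t. g (x + t *\<^sub>R axis k 1)) has_field_derivative 4 * (x $ k) * ((x $ k)\<^sup>2 - 1)) (at 0)"
      unfolding eq by (auto intro!: derivative_eq_intros simp: power2_eq_square algebra_simps)
    then show ?thesis unfolding partial_deriv_def by (rule DERIV_imp_deriv)
  qed
  have d2: "partial_deriv k (partial_deriv k g) 0 = - 4"
  proof -
    have "((\<lambda>t. partial_deriv k g (0 + t *\<^sub>R axis k 1)) has_field_derivative - 4) (at 0)"
      by (auto simp: d1 axis_def intro!: derivative_eq_intros)
    then show ?thesis unfolding partial_deriv_def[of k "partial_deriv k g"] by (rule DERIV_imp_deriv)
  qed
  have neg: "inner (axis k 1) (hessian g 0 *v axis k 1) = - 4"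
    by (simp add: inner_vec_def k matrix_vector_mult_def hessian_def d2)
  have "inner y (hessian g x *v y) \<ge> 0" for x y
  proof -
    obtain m :: nat and r where
      "(\<lambda>(x, y). inner y (hessian g x *v y)) = (\<lambda>z. \<Sum>i<m. (r i z)\<^sup>2)"
      using g by (auto simp: sos_convex_def is_sos_def)
    from fun_cong[OF this, of "(x, y)"] show ?thesis by (simp add: sum_nonneg)
  qed
  from this[of "axis k 1" 0] show False
    unfolding neg by simp
qed

end

theory Submission
  imports Defs
begin

text \<open>
  Expanding gives \<open>f(X) = (|X|\<^sup>2 + n)\<^sup>2 - 4 (tr X)\<^sup>2\<close>. Modulo the principal \<open>2 \<times> 2\<close> minors, on
  which \<open>g\<close> may depend linearly with any sign, \<open>(tr X)\<^sup>2\<close> equals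
  \<open>|X|\<^sup>2 - 1/2 \<Sum>\<^sub>i\<^sub>j (x\<^sub>i\<^sub>j - x\<^sub>j\<^sub>i)\<^sup>2\<close>. Hence, up to these linear terms,
  \<open>f = |X|\<^sup>4 + (2n - 4) |X|\<^sup>2 + 2 \<Sum>\<^sub>i\<^sub>j (x\<^sub>i\<^sub>j - x\<^sub>j\<^sub>i)\<^sup>2 + n\<^sup>2\<close>, and the quadratic part is
  a sum of squares as soon as \<open>n \<ge> 2\<close>.
\<close>

section \<open>Closure of SOS polynomials under sums and nonnegative scaling\<close>

lemma is_sos_sum_squares:
  assumes "finite A" "\<And>a. a \<in> A \<Longrightarrow> real_polynomial_function (r a)"
  shows "is_sos (\<lambda>z. \<Sum>a\<in>A. (r a z)\<^sup>2)"
proof -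
  obtain h where h: "bij_betw h {..<card A} A"
    using ex_bij_betw_nat_finite[OF assms(1)] by (auto simp: atLeast0LessThan)
  have "(\<Sum>a\<in>A. (r a z)\<^sup>2) = (\<Sum>i<card A. (r (h i) z)\<^sup>2)" for z
    by (rule sum.reindex_bij_betw[OF h, symmetric])
  moreover have "real_polynomial_function (r (h i))" if "i < card A" for i
    using assms(2) bij_betwE[OF h] that by blast
  ultimately show ?thesis
    unfolding is_sos_def by (intro exI[of _ "card A"] exI[of _ "\<lambda>i. r (h i)"]) auto
qed

lemma is_sos_square:
  assumes "real_polynomial_function r"
  shows "is_sos (\<lambda>z. (r z)\<^sup>2)"
  using is_sos_sum_squares[of "{()}" "\<lambda>_. r"] assms by simp

lemma is_sos_add:
  assumes "is_sos p" "is_sos q"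
  shows "is_sos (\<lambda>z. p z + q z)"
proof -
  obtain m r where r: "\<And>i. i < (m::nat) \<Longrightarrow> real_polynomial_function (r i)"
      "p = (\<lambda>z. \<Sum>i<m. (r i z)\<^sup>2)"
    using assms(1) by (auto simp: is_sos_def)
  obtain n s where s: "\<And>i. i < (n::nat) \<Longrightarrow> real_polynomial_function (s i)"
      "q = (\<lambda>z. \<Sum>i<n. (s i z)\<^sup>2)"
    using assms(2) by (auto simp: is_sos_def)
  \<comment> \<open>Indexing by the disjoint sum of both ranges concatenates the two lists of
    squares without arithmetic on indices.\<close>
  have "is_sos (\<lambda>z. \<Sum>a\<in>{..<m} <+> {..<n}. (case_sum r s a z)\<^sup>2)"
    by (rule is_sos_sum_squares) (auto simp: r s)
  then show ?thesis
    by (simp add: sum.Plus r(2) s(2))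
qed

lemma is_sos_cmult:
  assumes "is_sos q" "0 \<le> \<alpha>"
  shows "is_sos (\<lambda>z. \<alpha> * q z)"
proof -
  obtain m r where r: "\<And>i. i < (m::nat) \<Longrightarrow> real_polynomial_function (r i)"
      "q = (\<lambda>z. \<Sum>i<m. (r i z)\<^sup>2)"
    using assms(1) by (auto simp: is_sos_def)
  have "is_sos (\<lambda>z. \<Sum>i<m. (sqrt \<alpha> * r i z)\<^sup>2)"
    by (rule is_sos_sum_squares) (auto simp: r real_polynomial_function.intros)
  then show ?thesis
    using assms(2) by (simp add: r(2) power_mult_distrib sum_distrib_left)
qed

section \<open>Hessians and a family of SOS-convex quartics\<close>

lemma hessian_eqI:
  assumes "\<And>i x. ((\<lambda>t. g (x + t *\<^sub>R axis i 1)) has_real_derivative G i x) (at 0)"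
    and "\<And>i j x. ((\<lambda>t. G j (x + t *\<^sub>R axis i 1)) has_real_derivative H i j x) (at 0)"
  shows "hessian g x = (\<chi> i j. H i j x)"
proof -
  have "partial_deriv j g = G j" for j
    unfolding partial_deriv_def using assms(1) by (intro ext DERIV_imp_deriv)
  then have "partial_deriv i (partial_deriv j g) x = H i j x" for i j
    unfolding partial_deriv_def[of i "partial_deriv j g"] using assms(2)
    by (simp add: DERIV_imp_deriv)
  then show ?thesis
    by (simp add: hessian_def)
qed

lemma sum_axis_inner:
  fixes c y :: "real^'m::finite"
  shows "(\<Sum>i\<in>UNIV. y $ i * inner c (axis i 1)) = inner c y"
proof -
  have "inner c (axis i 1) = c $ i" for i
    by (simp add: inner_axis)
  then show ?thesis
    by (simp add: inner_vec_def mult.commute)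
qed

lemma real_polynomial_function_inner [intro]:
  "bounded_linear f \<Longrightarrow> real_polynomial_function (\<lambda>z. inner c (f z))"
  by (intro real_polynomial_function.intros(1) bounded_linear_compose[OF bounded_linear_inner_right])

text \<open>Along \<open>y\<close>, the Hessian form at \<open>x\<close> is
  \<open>8 S(x,y)^2 + 4 S(x,x) S(y,y) + 2 \<alpha> S(y,y) + 2 T(y,y)\<close>, where \<open>S\<close>
  and \<open>T\<close> are the bilinear forms of the two sums of squares; every summand is SOS. The
  affine part \<open>l\<close>, \<open>k\<close> does not enter, so its coefficients may have any
  sign.\<close>

lemma sos_convex_quartic:
  fixes c :: "'a \<Rightarrow> real^'m::finite" and d :: "'b \<Rightarrow> real^'m"
  assumes fin: "finite A" "finite B" and \<alpha>: "0 \<le> \<alpha>"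
  shows "sos_convex (\<lambda>v. (\<Sum>a\<in>A. (inner (c a) v)\<^sup>2)\<^sup>2 + \<alpha> * (\<Sum>a\<in>A. (inner (c a) v)\<^sup>2) +
    (\<Sum>b\<in>B. (inner (d b) v)\<^sup>2) + inner l v + k)" (is "sos_convex ?g")
proof -
  \<comment> \<open>Polarizing both quadratic forms makes every derivative along \<open>e i\<close>
    a value of \<open>S\<close> or \<open>T\<close>.\<close>
  define S where "S u v = (\<Sum>a\<in>A. inner (c a) u * inner (c a) v)" for u v
  define T where "T u v = (\<Sum>b\<in>B. inner (d b) u * inner (d b) v)" for u v
  define e :: "'m \<Rightarrow> real^'m" where "e i = axis i 1" for i
  have g: "?g v = (S v v)\<^sup>2 + \<alpha> * S v v + T v v + inner l v + k" for v
    by (simp add: S_def T_def power2_eq_square)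
  have lin: "((\<lambda>t. inner p (x + t *\<^sub>R e i)) has_real_derivative inner p (e i)) (at 0)"
    for p x i
    unfolding inner_add_right inner_scaleR_right by (auto intro!: derivative_eq_intros)
  have Slin: "((\<lambda>t. S (x + t *\<^sub>R e i) w) has_real_derivative S (e i) w) (at 0)" for x i w
    unfolding S_def by (auto intro!: derivative_eq_intros lin)
  have Tlin: "((\<lambda>t. T (x + t *\<^sub>R e i) w) has_real_derivative T (e i) w) (at 0)" for x i w
    unfolding T_def by (auto intro!: derivative_eq_intros lin)
  have S': "((\<lambda>t. S (x + t *\<^sub>R e i) (x + t *\<^sub>R e i)) has_real_derivative 2 * S x (e i)) (at 0)"
    for x i
    unfolding S_def
    by (auto intro!: derivative_eq_intros lin simp: sum_distrib_left algebra_simps)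
  have T': "((\<lambda>t. T (x + t *\<^sub>R e i) (x + t *\<^sub>R e i)) has_real_derivative 2 * T x (e i)) (at 0)"
    for x i
    unfolding T_def
    by (auto intro!: derivative_eq_intros lin simp: sum_distrib_left algebra_simps)
  define G where "G i x = 4 * S x x * S x (e i) + 2 * \<alpha> * S x (e i) + 2 * T x (e i) + inner l (e i)"
    for i x
  define H where "H i j x = 8 * S x (e i) * S x (e j) + 4 * S x x * S (e i) (e j)
    + 2 * \<alpha> * S (e i) (e j) + 2 * T (e i) (e j)" for i j x
  have "hessian ?g x = (\<chi> i j. H i j x)" for x
  proof (rule hessian_eqI)
    show "((\<lambda>t. ?g (x + t *\<^sub>R axis i 1)) has_real_derivative G i x) (at 0)" for i x
      unfolding g G_def e_def[symmetric]
      by (auto intro!: derivative_eq_intros lin S' T')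
    show "((\<lambda>t. G j (x + t *\<^sub>R axis i 1)) has_real_derivative H i j x) (at 0)" for i j x
      unfolding G_def H_def e_def[of i, symmetric]
      by (auto intro!: derivative_eq_intros Slin Tlin S')
  qed
  moreover have "inner y ((\<chi> i j. H i j x) *v y) =
      8 * (S x y)\<^sup>2 + 4 * (S x x * S y y) + 2 * \<alpha> * S y y + 2 * T y y" for x y
  proof -
    \<comment> \<open>Linearity in the second argument, with \<open>y\<close> expanded in the
      standard basis.\<close>
    have Sy: "(\<Sum>i\<in>UNIV. y $ i * S w (e i)) = S w y" for w
      unfolding S_def e_def sum_axis_inner[of y "c _", symmetric] sum_distrib_left
      by (subst sum.swap) (simp add: ac_simps)
    have Ty: "(\<Sum>i\<in>UNIV. y $ i * T w (e i)) = T w y" for w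
      unfolding T_def e_def sum_axis_inner[of y "d _", symmetric] sum_distrib_left
      by (subst sum.swap) (simp add: ac_simps)
    have comm: "S u v = S v u" "T u v = T v u" for u v
      by (simp_all add: S_def T_def mult.commute)
    \<comment> \<open>The index \<open>j\<close> is contracted first; by symmetry \<open>e i\<close>
      is moved to the second slot, where \<open>Sy\<close> and \<open>Ty\<close> can contract
      \<open>i\<close> afterwards.\<close>
    have row: "(\<Sum>j\<in>UNIV. H i j x * y $ j) = 8 * S x (e i) * S x y + 4 * S x x * S y (e i)
        + 2 * \<alpha> * S y (e i) + 2 * T y (e i)" for i
      unfolding comm(1)[of y "e i"] comm(2)[of y "e i"] Sy[symmetric] Ty[symmetric]
      by (simp add: H_def sum.distrib sum_distrib_left algebra_simps)
    have "inner y ((\<chi> i j. H i j x) *v y) = (\<Sum>i\<in>UNIV. y $ i * (\<Sum>j\<in>UNIV. H i j x * y $ j))"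
      by (simp add: inner_vec_def matrix_vector_mult_def)
    also have "\<dots> = 8 * S x y * (\<Sum>i\<in>UNIV. y $ i * S x (e i))
        + (4 * S x x + 2 * \<alpha>) * (\<Sum>i\<in>UNIV. y $ i * S y (e i)) + 2 * (\<Sum>i\<in>UNIV. y $ i * T y (e i))"
      unfolding row by (simp add: sum.distrib sum_distrib_left algebra_simps)
    finally show ?thesis
      by (simp add: Sy Ty power2_eq_square algebra_simps)
  qed
  moreover have "is_sos (\<lambda>(x, y). 8 * (S x y)\<^sup>2 + 4 * (S x x * S y y) + 2 * \<alpha> * S y y + 2 * T y y)"
  proof -
    note poly = real_polynomial_function_inner[OF bounded_linear_fst]
      real_polynomial_function_inner[OF bounded_linear_snd]
    have "is_sos (\<lambda>z. (S (fst z) (snd z))\<^sup>2)"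
      unfolding S_def
      by (intro is_sos_square real_polynomial_function_sum fin real_polynomial_function.intros(4) poly)
    moreover have "is_sos (\<lambda>z. S (fst z) (fst z) * S (snd z) (snd z))"
    proof -
      \<comment> \<open>A product of two sums of squares is the sum of the squares of all pairwise
        products.\<close>
      have "is_sos (\<lambda>z. \<Sum>(a, b)\<in>A \<times> A. (inner (c a) (fst z) * inner (c b) (snd z))\<^sup>2)"
        unfolding case_prod_unfold using fin
        by (intro is_sos_sum_squares real_polynomial_function.intros(4) poly) auto
      then show ?thesis
        by (simp add: S_def sum_product sum.cartesian_product power2_eq_square ac_simps)
    qed
    moreover have "is_sos (\<lambda>z. S (snd z) (snd z))" "is_sos (\<lambda>z. T (snd z) (snd z))"
      unfolding S_def T_def power2_eq_square[symmetric]
      by (intro is_sos_sum_squares fin poly)+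
    ultimately show ?thesis
      unfolding case_prod_unfold by (intro is_sos_add is_sos_cmult) (use \<alpha> in auto)
  qed
  moreover have "real_polynomial_function ?g"
    by (intro real_polynomial_function.intros(2-) real_polynomial_function_power
        real_polynomial_function_sum fin real_polynomial_function_inner bounded_linear_ident)
  ultimately show ?thesis
    unfolding sos_convex_def by (simp add: case_prod_unfold)
qed

section \<open>The minors of orders one and two that are needed\<close>

definition entry_index :: "'n::finite \<Rightarrow> 'n \<Rightarrow> 'n minor_index" where
  "entry_index i j = Abs_minor_index ({i}, {j})"

text \<open>For \<open>i \<noteq> j\<close> this indexes a principal minor of order two, the same
  for both orders of the pair. For \<open>i = j\<close> the set collapses and the index is that of
  the entry \<open>(i, i)\<close>, hence the case split in \<open>l\<close> below.\<close>

definition pair_index :: "'n::finite \<Rightarrow> 'n \<Rightarrow> 'n minor_index" where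
  "pair_index i j = Abs_minor_index ({i, j}, {i, j})"

lemma minors_entry_index: "minors X $ entry_index i j = X $ i $ j"
  by (simp add: minors_def entry_index_def Abs_minor_index_inverse minor_def det_single)

lemma det_mat_2:
  "Determinant.det (Matrix.mat 2 2 f) = f (0, 0) * f (1, 1) - f (0, 1) * f (1, 0)"
proof -
  have "mat_delete (Matrix.mat 2 2 f) 0 j \<in> carrier_mat 1 1" for j
    by (simp add: mat_delete_def)
  then show ?thesis
    by (subst laplace_expansion_row[of _ 2 0])
      (auto simp: numeral_2_eq_2 cofactor_def det_single mat_delete_def)
qed

text \<open>The claim is symmetric in \<open>i\<close> and \<open>j\<close>, so \<open>i < j\<close>
  may be assumed; then the sorted rows and columns are \<open>[i, j]\<close>.\<close>

lemma minors_pair_index: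
  fixes X :: "'n::{finite,linorder} sq_matrix"
  assumes "i \<noteq> j"
  shows "minors X $ pair_index i j = X $ i $ i * X $ j $ j - X $ i $ j * X $ j $ i"
  using assms
proof (induction i j rule: linorder_wlog)
  case (le i j)
  then have "i < j" by simp
  then have "sorted_list_of_set {i, j} = [i, j]"
    by auto
  with le show ?case
    by (simp add: minors_def pair_index_def Abs_minor_index_inverse minor_def
        det_mat_2[unfolded numeral_2_eq_2])
next
  case (sym i j)
  then show ?case
    by (simp add: pair_index_def insert_commute)
qed

section \<open>Identities for the norm, the trace and the double well\<close>

lemma frobenius_norm_power2:
  "(frobenius_norm X)\<^sup>2 = (\<Sum>i\<in>UNIV. \<Sum>j\<in>UNIV. (X $ i $ j)\<^sup>2)"
proof -
  have "trace (Finite_Cartesian_Product.transpose X ** X) = (\<Sum>i\<in>UNIV. \<Sum>j\<in>UNIV. (X $ i $ j)\<^sup>2)"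
    unfolding trace_def matrix_matrix_mult_def Finite_Cartesian_Product.transpose_def
    by (simp add: power2_eq_square) (rule sum.swap)
  then show ?thesis
    by (simp add: frobenius_norm_def sum_nonneg)
qed

lemma double_well_eq:
  fixes X :: "'n::finite sq_matrix"
  shows "double_well X = ((frobenius_norm X)\<^sup>2 + real CARD('n))\<^sup>2 - 4 * (trace X)\<^sup>2"
proof -
  \<comment> \<open>With \<open>s = 1\<close> and \<open>s = -1\<close> the two factors differ only
    in the sign of \<open>2 * trace X\<close>, so their product is a difference of squares.\<close>
  have *: "(frobenius_norm (X + s *\<^sub>R mat 1))\<^sup>2 =
      (frobenius_norm X)\<^sup>2 + 2 * s * trace X + s\<^sup>2 * real CARD('n)" for s
  proof -
    have "((X + s *\<^sub>R mat 1) $ i $ j)\<^sup>2 =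
        (X $ i $ j)\<^sup>2 + (if i = j then 2 * s * X $ i $ j + s\<^sup>2 else 0)" for i j
      by (simp add: Finite_Cartesian_Product.mat_def power2_eq_square algebra_simps)
    then show ?thesis
      by (simp add: frobenius_norm_power2 trace_def sum.distrib sum_distrib_left)
  qed
  show ?thesis
    using *[of "-1"] *[of 1]
    by (simp add: double_well_def) (simp add: power2_eq_square algebra_simps)
qed

text \<open>Expanding the squared differences yields \<open>X $ i $ j * X $ j $ i\<close>, the part
  by which the products of diagonal entries in \<open>(trace X)^2\<close> differ from principal
  minors. The terms with \<open>i = j\<close> in the last sum vanish.\<close>

lemma trace_power2_eq:
  fixes X :: "'n::finite sq_matrix"
  shows "(trace X)\<^sup>2 = (frobenius_norm X)\<^sup>2 - (\<Sum>i\<in>UNIV. \<Sum>j\<in>UNIV. (X $ i $ j - X $ j $ i)\<^sup>2) / 2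
    + (\<Sum>i\<in>UNIV. \<Sum>j\<in>UNIV. X $ i $ i * X $ j $ j - X $ i $ j * X $ j $ i)"
proof -
  have "(\<Sum>i\<in>UNIV. \<Sum>j\<in>UNIV. (X $ j $ i)\<^sup>2) = (frobenius_norm X)\<^sup>2"
    unfolding frobenius_norm_power2 by (rule sum.swap)
  then have "(\<Sum>i\<in>UNIV. \<Sum>j\<in>UNIV. (X $ i $ j - X $ j $ i)\<^sup>2) =
      2 * (frobenius_norm X)\<^sup>2 - 2 * (\<Sum>i\<in>UNIV. \<Sum>j\<in>UNIV. X $ i $ j * X $ j $ i)"
    by (simp add: frobenius_norm_power2 power2_diff sum.distrib sum_subtractf sum_distrib_left mult.assoc)
  moreover have "(trace X)\<^sup>2 = (\<Sum>i\<in>UNIV. \<Sum>j\<in>UNIV. X $ i $ i * X $ j $ j)"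
    by (simp add: trace_def power2_eq_square sum_product)
  ultimately show ?thesis
    by (simp add: sum_subtractf field_simps)
qed

text \<open>Only squares of the norm occur, so the square root disappears.\<close>

lemma real_polynomial_function_double_well:
  "real_polynomial_function (double_well :: 'n::finite sq_matrix \<Rightarrow> real)"
proof -
  have "real_polynomial_function (\<lambda>X :: 'n sq_matrix. X $ i $ j)" for i j
    by (intro real_polynomial_function.intros(1) bounded_linear_compose[OF bounded_linear_vec_nth]
        bounded_linear_vec_nth)
  then show ?thesis
    unfolding double_well_def frobenius_norm_power2 vector_add_component vector_minus_component
    by (intro real_polynomial_function.intros(2-) real_polynomial_function_diff
        real_polynomial_function_power real_polynomial_function_sum) auto
qed

theorem mainTheorem5:
  assumes "CARD('n::{finite,linorder}) \<ge> 2"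
  shows "lifted_sos_polyconvex
    (double_well :: 'n sq_matrix \<Rightarrow> real)"
proof -
  let ?n = "real CARD('n)"
  define c :: "'n \<times> 'n \<Rightarrow> real^('n minor_index)"
    where "c = (\<lambda>(i, j). axis (entry_index i j) 1)"
  \<comment> \<open>The factor \<open>sqrt 2\<close> squares to \<open>2 = (-4) * (-1/2)\<close>,
    the coefficient of the squared differences in \<open>-4 * (trace X)^2\<close>.\<close>
  define d where "d = (\<lambda>(i, j). sqrt 2 *\<^sub>R (c (i, j) - c (j, i)))"
  \<comment> \<open>Each ordered pair carries the \<open>-4\<close> of
    \<open>-4 * (trace X)^2\<close>.\<close>
  define l :: "real^('n minor_index)" where
    "l = (\<Sum>(i, j)\<in>UNIV. if i = j then 0 else axis (pair_index i j) (- 4))"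
  \<comment> \<open>In \<open>2 * ?n - 4\<close>, the first term is the cross term of
    \<open>(|X|^2 + n)^2\<close> and the second comes from the trace.\<close>
  define g where "g v = (\<Sum>p\<in>UNIV. (inner (c p) v)\<^sup>2)\<^sup>2 + (2 * ?n - 4) * (\<Sum>p\<in>UNIV. (inner (c p) v)\<^sup>2)
    + (\<Sum>p\<in>UNIV. (inner (d p) v)\<^sup>2) + inner l v + ?n\<^sup>2" for v
  have "sos_convex g"
    \<comment> \<open>Here \<open>n \<ge> 2\<close> makes \<open>2 * ?n - 4\<close>
      nonnegative.\<close>
    unfolding g_def by (rule sos_convex_quartic) (use assms in auto)
  moreover have "double_well X = g (minors X)" for X :: "'n sq_matrix"
  proof -
    have c: "inner (c (i, j)) (minors X) = X $ i $ j" for i j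
      by (simp add: c_def inner_axis' minors_entry_index)
    have sum_pairs: "(\<Sum>p\<in>UNIV. h p) = (\<Sum>i\<in>UNIV. \<Sum>j\<in>UNIV. h (i, j))"
      for h :: "'n \<times> 'n \<Rightarrow> real"
      by (simp add: sum.cartesian_product)
    have "(\<Sum>p\<in>UNIV. (inner (c p) (minors X))\<^sup>2) = (frobenius_norm X)\<^sup>2"
      by (simp add: sum_pairs c frobenius_norm_power2)
    moreover have "(\<Sum>p\<in>UNIV. (inner (d p) (minors X))\<^sup>2) =
        2 * (\<Sum>i\<in>UNIV. \<Sum>j\<in>UNIV. (X $ i $ j - X $ j $ i)\<^sup>2)"
      by (simp add: sum_pairs d_def inner_diff_left c power_mult_distrib sum_distrib_left)
    moreover have "inner l (minors X) =
        - 4 * (\<Sum>i\<in>UNIV. \<Sum>j\<in>UNIV. X $ i $ i * X $ j $ j - X $ i $ j * X $ j $ i)"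
      unfolding l_def inner_sum_left sum_pairs sum_distrib_left
      \<comment> \<open>On the diagonal both summands are zero.\<close>
      by (intro sum.cong refl) (auto simp: inner_axis' minors_pair_index)
    ultimately show ?thesis
      unfolding double_well_eq trace_power2_eq g_def by (simp add: power2_sum field_simps)
  qed
  ultimately show ?thesis
    unfolding lifted_sos_polyconvex_def
    using real_polynomial_function_double_well by (auto simp: fun_eq_iff)
qed

end
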